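(* Let $S$ be a finite non-empty set and let $f\colon 2^S\to[0,\infty)$ be non-decreasing and submodular with $f(\emptyset)=0$ and $f(A)>0$ for all $A\ne\emptyset$. Then every equilibrium (optimal mixed) strategy for the Hider in the submodular search game is in the scaled base polyhedron $\frac{1}{f(S)}\mathbb B(f)$.
   Context: The submodular search game is the finite two-person zero-sum game in which a pure strategy of the Searcher (minimizer) is a permutation $\pi$ of $S$, a pure strategy of the Hider (maximizer) is an element $j\in S$, and the payoff is $f(S_j^\pi)$, where $S_j^\pi$ is the set consisting of $j$ and all elements preceding $j$ in $\pi$. A mixed Hider strategy is a probability distribution $\mathbf x\in[0,1]^S$ on $S$. The base polyhedron is $\mathbb B(f)=\{\mathbf x\in\mathbb R^S:\ \mathbf x(A)\le f(A)\text{ for all }A\subseteq S,\ \mathbf x(S)=f(S)\}$, where $\mathbf x(A)=\sum_{s\in A}x_s$. *)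

theory Defs
  imports Complex_Main "HOL-Library.FuncSet" "HOL-Combinatorics.Multiset_Permutations"
begin

definition submodular_on :: "'a set \<Rightarrow> ('a set \<Rightarrow> real) \<Rightarrow> bool" where
  "submodular_on S f \<longleftrightarrow>
    (\<forall>A B. A \<subseteq> S \<longrightarrow> B \<subseteq> S \<longrightarrow> f (A \<union> B) + f (A \<inter> B) \<le> f A + f B)"

text \<open>Points of \<open>\<real>\<^sup>S\<close> are functions that are \<^const>\<open>undefined\<close> outside \<open>S\<close>.\<close>

definition base_polyhedron :: "'a set \<Rightarrow> ('a set \<Rightarrow> real) \<Rightarrow> ('a \<Rightarrow> real) set" where
  "base_polyhedron S f =
    {x \<in> S \<rightarrow>\<^sub>E (UNIV :: real set). (\<forall>A. A \<subseteq> S \<longrightarrow> sum x A \<le> f A) \<and> sum x S = f S}"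

definition scale_on :: "'a set \<Rightarrow> real \<Rightarrow> ('a \<Rightarrow> real) set \<Rightarrow> ('a \<Rightarrow> real) set" where
  "scale_on S c P = (\<lambda>x. \<lambda>s\<in>S. c * x s) ` P"

definition mixed_strategies :: "'b set \<Rightarrow> ('b \<Rightarrow> real) set" where
  "mixed_strategies X = {w \<in> X \<rightarrow>\<^sub>E {0..1}. sum w X = 1}"

text \<open>A permutation of \<open>S\<close> is the list of all elements of \<open>S\<close> in the order in which they
  are searched, i.e. an element of \<^term>\<open>permutations_of_set S\<close>.\<close>

definition searched_upto :: "'a list \<Rightarrow> 'a \<Rightarrow> 'a set" where
  "searched_upto \<pi> j = insert j (set (takeWhile (\<lambda>i. i \<noteq> j) \<pi>))"

definition expected_payoff ::
    "'a set \<Rightarrow> ('a set \<Rightarrow> real) \<Rightarrow> ('a list \<Rightarrow> real) \<Rightarrow> ('a \<Rightarrow> real) \<Rightarrow> real" where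
  "expected_payoff S f p x =
    (\<Sum>\<pi>\<in>permutations_of_set S. \<Sum>j\<in>S. p \<pi> * x j * f (searched_upto \<pi> j))"

text \<open>The Searcher (strategy \<open>p\<close>) minimizes and the Hider (strategy \<open>x\<close>) maximizes.\<close>

definition equilibrium ::
    "'a set \<Rightarrow> ('a set \<Rightarrow> real) \<Rightarrow> ('a list \<Rightarrow> real) \<Rightarrow> ('a \<Rightarrow> real) \<Rightarrow> bool" where
  "equilibrium S f p x \<longleftrightarrow>
    p \<in> mixed_strategies (permutations_of_set S) \<and> x \<in> mixed_strategies S \<and>
    (\<forall>q \<in> mixed_strategies (permutations_of_set S).
       expected_payoff S f p x \<le> expected_payoff S f q x) \<and>
    (\<forall>y \<in> mixed_strategies S. expected_payoff S f p y \<le> expected_payoff S f p x)"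

definition hider_equilibrium_strategy ::
    "'a set \<Rightarrow> ('a set \<Rightarrow> real) \<Rightarrow> ('a \<Rightarrow> real) \<Rightarrow> bool" where
  "hider_equilibrium_strategy S f x \<longleftrightarrow> (\<exists>p. equilibrium S f p x)"

end

theory Submission
  imports Defs
begin

text \<open>
  Suppose the Hider's equilibrium strategy \<open>x\<close> violates an inequality of the scaled base polyhedron.
  Then the largest set \<open>M\<close> maximizing the density \<open>x(A) / f(A)\<close> is not all of \<open>S\<close>. Searching \<open>M\<close>
  first (and otherwise keeping the order) never increases the Searcher's cost against \<open>x\<close>, and
  it decreases it strictly unless every element of \<open>M\<close> of positive weight is found at cost at most
  \<open>f(M)\<close> and every element outside \<open>M\<close> at cost more than \<open>f(M)\<close>. So this holds for every search in the
  support of an optimal Searcher strategy, and the Hider would gain by moving weight out of \<open>M\<close>.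
\<close>

section \<open>Sets searched along a permutation\<close>

lemma searched_upto_append_Cons:
  assumes "j \<notin> set xs"
  shows "searched_upto (xs @ j # ys) j = insert j (set xs)"
proof -
  have "takeWhile (\<lambda>i. i \<noteq> j) (xs @ j # ys) = xs"
    using assms by (subst takeWhile_append2) auto
  then show ?thesis
    by (simp add: searched_upto_def)
qed

lemma searched_upto_append_left:
  assumes "j \<in> set xs"
  shows "searched_upto (xs @ ys) j = searched_upto xs j"
  using assms by (auto simp: searched_upto_def takeWhile_append1)

lemma searched_upto_subset:
  assumes "j \<in> set xs"
  shows "searched_upto xs j \<subseteq> set xs"
  using assms by (auto simp: searched_upto_def dest: set_takeWhileD)

lemma searched_upto_refl: "j \<in> searched_upto xs j"
  by (simp add: searched_upto_def)

text \<open>If \<open>i\<close> differed from \<open>j\<close>, it would stand before the first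
  \<open>j\<close>, and so would everything searched up to \<open>i\<close>.\<close>

lemma searched_upto_antisym:
  assumes "distinct xs" "j \<in> set xs" "i \<in> searched_upto xs j" "j \<in> searched_upto xs i"
  shows "i = j"
proof (rule ccontr)
  assume "i \<noteq> j"
  obtain as bs where xs: "xs = as @ j # bs" and j: "j \<notin> set as"
    using split_list_first[OF assms(2)] by blast
  have "i \<in> set as"
    using assms(3) \<open>i \<noteq> j\<close> j by (simp add: xs searched_upto_append_Cons)
  then have "j \<in> searched_upto as i"
    using assms(4) by (simp add: xs searched_upto_append_left)
  then show False
    using searched_upto_subset[OF \<open>i \<in> set as\<close>] j by auto
qed

definition search_first :: "'a set \<Rightarrow> 'a list \<Rightarrow> 'a list" where
  "search_first M xs = filter (\<lambda>i. i \<in> M) xs @ filter (\<lambda>i. i \<notin> M) xs"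

lemma search_first_permutation:
  "xs \<in> permutations_of_set S \<Longrightarrow> search_first M xs \<in> permutations_of_set S"
  by (auto simp: search_first_def permutations_of_set_def)

lemma searched_upto_search_first:
  assumes "distinct xs" "j \<in> set xs" "M \<subseteq> set xs"
  shows "searched_upto (search_first M xs) j =
    (if j \<in> M then M \<inter> searched_upto xs j else M \<union> searched_upto xs j)"
proof -
  obtain as bs where xs: "xs = as @ j # bs" and j: "j \<notin> set as"
    using split_list_first[OF assms(2)] by blast
  show ?thesis
  proof (cases "j \<in> M")
    case True
    then have "search_first M xs = filter (\<lambda>i. i \<in> M) as @ j #
        (filter (\<lambda>i. i \<in> M) bs @ filter (\<lambda>i. i \<notin> M) xs)"
      by (simp add: search_first_def xs)
    then show ?thesis
      using True j by (auto simp: searched_upto_append_Cons xs)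
  next
    case False
    then have "search_first M xs = (filter (\<lambda>i. i \<in> M) xs @ filter (\<lambda>i. i \<notin> M) as) @ j #
        filter (\<lambda>i. i \<notin> M) bs"
      by (simp add: search_first_def xs)
    moreover have "j \<notin> set (filter (\<lambda>i. i \<in> M) xs @ filter (\<lambda>i. i \<notin> M) as)"
      using False j by auto
    ultimately have "searched_upto (search_first M xs) j =
        insert j (set (filter (\<lambda>i. i \<in> M) xs @ filter (\<lambda>i. i \<notin> M) as))"
      by (metis searched_upto_append_Cons)
    also have "\<dots> = M \<union> insert j (set as)"
      using assms(3) by auto
    finally show ?thesis
      using False j by (simp add: searched_upto_append_Cons xs)
  qed
qed

section \<open>Searching a densest set first\<close>

definition search_cost :: "'a set \<Rightarrow> ('a set \<Rightarrow> real) \<Rightarrow> ('a \<Rightarrow> real) \<Rightarrow> 'a list \<Rightarrow> real" where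
  "search_cost S f x xs = (\<Sum>j\<in>S. x j * f (searched_upto xs j))"

text \<open>In the intended instance \<open>\<rho>\<close> is the maximum of
  \<open>x(A) / f(A)\<close> and \<open>M\<close> is the greatest set attaining it. The density
  bound is multiplied out so that it also covers the empty set; sets with equality are called tight
  below.\<close>

locale densest_set =
  fixes S :: "'a set" and f :: "'a set \<Rightarrow> real" and x :: "'a \<Rightarrow> real"
    and M :: "'a set" and \<rho> :: real
  assumes finite_S: "finite S"
    and f_mono: "A \<subseteq> B \<Longrightarrow> B \<subseteq> S \<Longrightarrow> f A \<le> f B"
    and f_submodular: "A \<subseteq> S \<Longrightarrow> B \<subseteq> S \<Longrightarrow> f (A \<union> B) + f (A \<inter> B) \<le> f A + f B"
    and x_nonneg: "j \<in> S \<Longrightarrow> 0 \<le> x j"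
    and \<rho>_pos: "0 < \<rho>"
    and M_subset: "M \<subseteq> S"
    and density_le: "A \<subseteq> S \<Longrightarrow> sum x A \<le> \<rho> * f A"
    and M_tight: "sum x M = \<rho> * f M"
    and M_largest: "A \<subseteq> S \<Longrightarrow> sum x A = \<rho> * f A \<Longrightarrow> A \<subseteq> M"
begin

lemma finite_subset_S: "A \<subseteq> S \<Longrightarrow> finite A"
  using finite_S finite_subset by blast

lemma x_mono: "A \<subseteq> B \<Longrightarrow> B \<subseteq> S \<Longrightarrow> sum x A \<le> sum x B"
  by (rule sum_mono2) (auto intro: finite_subset_S x_nonneg)

section \<open>Gains, potential and their change in one search step\<close>

definition excess :: "'a set \<Rightarrow> real" where
  "excess F = f (M \<union> F) - f M"

definition deficit :: "'a set \<Rightarrow> real" where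
  "deficit F = f M - f (M \<inter> F)"

text \<open>With \<open>F\<close> the set searched up to \<open>j\<close>, submodularity makes this
  a lower bound for the weighted cost that \<open>j\<close> saves when \<open>M\<close> is moved to
  the front. Elements outside \<open>M\<close> may lose, hence the sign.\<close>

definition gain :: "'a set \<Rightarrow> 'a \<Rightarrow> real" where
  "gain F j = (if j \<in> M then x j * excess F else - x j * deficit F)"

text \<open>The potential vanishes for \<open>F = {}\<close> and \<open>F = S\<close>, and along a search it grows by at most the gain
  of each step; this replaces a summation by parts.\<close>

definition potential :: "'a set \<Rightarrow> real" where
  "potential F = (\<rho> * excess F - sum x (F - M)) * deficit F - sum x (M - F) * excess F"

text \<open>For a permutation of \<open>S\<close> this is the total gain, as the potential of
  \<open>S\<close> is zero. For shorter lists the potential is subtracted to make every single step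
  non-negative.\<close>

definition slack :: "'a list \<Rightarrow> real" where
  "slack xs = (\<Sum>j\<in>set xs. gain (searched_upto xs j) j) - potential (set xs)"

text \<open>As \<open>M\<close> is tight, the expression is the value of
  \<open>\<rho> * f - x\<close> at \<open>M \<union> F\<close>. The density bound makes it
  non-negative. If \<open>F\<close> leaves \<open>M\<close>, then \<open>M \<union> F\<close> cannot
  be tight, since \<open>M\<close> contains every tight set.\<close>

lemma surplus:
  assumes "F \<subseteq> S"
  shows "0 \<le> \<rho> * excess F - sum x (F - M)"
    and "\<not> F \<subseteq> M \<Longrightarrow> 0 < \<rho> * excess F - sum x (F - M)"
proof -
  have "sum x (M \<union> (F - M)) = sum x M + sum x (F - M)"
    using assms M_subset finite_subset_S by (intro sum.union_disjoint) auto
  then have eq: "\<rho> * excess F - sum x (F - M) = \<rho> * f (M \<union> F) - sum x (M \<union> F)"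
    using M_tight by (simp add: excess_def algebra_simps)
  have le: "sum x (M \<union> F) \<le> \<rho> * f (M \<union> F)"
    using assms M_subset by (intro density_le) auto
  then show "0 \<le> \<rho> * excess F - sum x (F - M)"
    by (simp add: eq)
  assume "\<not> F \<subseteq> M"
  then have "sum x (M \<union> F) \<noteq> \<rho> * f (M \<union> F)"
    using M_largest[of "M \<union> F"] assms M_subset by auto
  with le show "0 < \<rho> * excess F - sum x (F - M)"
    by (simp add: eq)
qed

lemma f_less_union:
  assumes "F \<subseteq> S" "\<not> F \<subseteq> M"
  shows "f M < f (M \<union> F)"
proof -
  have "0 \<le> sum x (F - M)"
    using assms(1) x_nonneg by (intro sum_nonneg) auto
  then have "0 < \<rho> * excess F"
    using surplus(2)[OF assms] by linarith
  then show ?thesis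
    using \<rho>_pos by (simp add: excess_def zero_less_mult_iff)
qed

text \<open>Subtract the density bound of \<open>M \<inter> F\<close> from the tightness of
  \<open>M\<close>.\<close>

lemma deficit_le_weight: "\<rho> * deficit F \<le> sum x (M - F)"
proof -
  have "sum x M = sum x (M \<inter> F) + sum x (M - F)"
    using M_subset by (intro sum.Int_Diff) (rule finite_subset_S)
  moreover have "sum x (M \<inter> F) \<le> \<rho> * f (M \<inter> F)"
    using M_subset by (intro density_le) auto
  ultimately show ?thesis
    using M_tight by (simp add: deficit_def algebra_simps)
qed

lemma deficit_antimono: "F \<subseteq> G \<Longrightarrow> deficit G \<le> deficit F"
  using f_mono[of "M \<inter> F" "M \<inter> G"] M_subset by (auto simp: deficit_def)

lemma excess_mono: "F \<subseteq> G \<Longrightarrow> G \<subseteq> S \<Longrightarrow> excess F \<le> excess G"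
  unfolding excess_def using M_subset f_mono[of "M \<union> F" "M \<union> G"] by auto

text \<open>Only the excess and the weight of \<open>F - M\<close> change, and the contribution of
  \<open>x a\<close> to the potential cancels the gain. The two factors left are non-negative by
  monotonicity of \<open>f\<close> and by \<open>deficit_le_weight\<close>.\<close>

lemma potential_step_outside:
  assumes "a \<notin> M" "a \<notin> F" "F \<subseteq> S" "a \<in> S"
  shows "gain (insert a F) a - (potential (insert a F) - potential F) =
    (excess (insert a F) - excess F) * (sum x (M - F) - \<rho> * deficit F)"
proof -
  have "finite (F - M)"
    using assms finite_subset_S by blast
  moreover have "insert a F - M = insert a (F - M)" "M - insert a F = M - F"
    "M \<inter> insert a F = M \<inter> F"
    using assms by auto
  ultimately show ?thesis
    using assms by (simp add: gain_def potential_def deficit_def algebra_simps)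
qed

text \<open>Only the deficit and the weight of \<open>M - F\<close> change, and the loss of
  \<open>x a\<close> in the latter cancels the gain. The two factors left are non-negative by
  \<open>surplus\<close> and by monotonicity of \<open>f\<close>.\<close>

lemma potential_step_inside:
  assumes "a \<in> M" "a \<notin> F"
  shows "gain (insert a F) a - (potential (insert a F) - potential F) =
    (\<rho> * excess F - sum x (F - M)) * (deficit F - deficit (insert a F))"
proof -
  have "finite M"
    using M_subset by (rule finite_subset_S)
  then have "sum x (M - F) = x a + sum x (M - insert a F)"
    using assms by (subst sum.remove[of _ a]) (auto intro!: sum.cong)
  moreover have "insert a F - M = F - M" "excess (insert a F) = excess F"
    using assms by (auto simp: excess_def insert_absorb)
  ultimately show ?thesis
    using assms by (simp add: gain_def potential_def algebra_simps)
qed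

section \<open>Slack of a search and the structure of optimal searches\<close>

lemma slack_snoc:
  assumes "a \<notin> set xs"
  shows "slack (xs @ [a]) = slack xs + (gain (insert a (set xs)) a
    - (potential (insert a (set xs)) - potential (set xs)))"
proof -
  have "(\<Sum>j\<in>set xs. gain (searched_upto (xs @ [a]) j) j) =
      (\<Sum>j\<in>set xs. gain (searched_upto xs j) j)"
    by (intro sum.cong) (simp_all add: searched_upto_append_left)
  then show ?thesis
    using assms by (simp add: slack_def searched_upto_append_Cons)
qed

text \<open>Slack is a sum of non-negative steps, so zero slack makes every step a product with a
  zero factor. The conclusion is phrased for prefixes to allow induction; for a full search the
  deficit at the end is 0, so all the value and weight of \<open>M\<close> has been collected before
  any \<open>i\<close> outside \<open>M\<close>.\<close>

lemma slack_nonneg_and_tight: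
  assumes "distinct xs" "set xs \<subseteq> S"
  shows "0 \<le> slack xs \<and> (slack xs = 0 \<longrightarrow> (\<forall>i \<in> set xs - M.
    deficit (searched_upto xs i) = deficit (set xs) \<and>
    sum x (M - searched_upto xs i) = \<rho> * deficit (set xs)))"
  using assms
proof (induction xs rule: rev_induct)
  case Nil
  then show ?case
    by (simp add: slack_def potential_def excess_def)
next
  case (snoc a xs)
  define F where "F = set xs"
  have a: "a \<notin> F" "a \<in> S" "F \<subseteq> S" and IH: "0 \<le> slack xs"
    and IH0: "\<And>i. slack xs = 0 \<Longrightarrow> i \<in> F - M \<Longrightarrow>
      deficit (searched_upto xs i) = deficit F \<and> sum x (M - searched_upto xs i) = \<rho> * deficit F"
    using snoc by (auto simp: F_def)
  have old: "searched_upto (xs @ [a]) i = searched_upto xs i" if "i \<in> F" for i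
    using that by (simp add: F_def searched_upto_append_left)
  have new: "searched_upto (xs @ [a]) a = insert a F"
    using a by (simp add: F_def searched_upto_append_Cons)
  have set: "set (xs @ [a]) = insert a F"
    by (simp add: F_def)
  \<comment> \<open>The weight of \<open>M\<close> left now is at most the weight left when
    \<open>i\<close> was found, and that already equals the general lower bound
    \<open>\<rho> * deficit F\<close>.\<close>
  have weight: "sum x (M - F) = \<rho> * deficit F" if "slack xs = 0" "i \<in> F - M" for i
  proof (rule antisym)
    have "searched_upto xs i \<subseteq> F"
      unfolding F_def using that by (intro searched_upto_subset) (simp add: F_def)
    then have "sum x (M - F) \<le> sum x (M - searched_upto xs i)"
      using M_subset by (intro x_mono) auto
    then show "sum x (M - F) \<le> \<rho> * deficit F"
      using IH0[OF that] by simp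
  qed (rule deficit_le_weight)
  show ?case
  proof (cases "a \<in> M")
    case False
    let ?step = "(excess (insert a F) - excess F) * (sum x (M - F) - \<rho> * deficit F)"
    have slack: "slack (xs @ [a]) = slack xs + ?step"
      using slack_snoc[of a xs] potential_step_outside[OF False a(1,3,2)] a(1) by (simp add: F_def)
    have step: "0 \<le> ?step"
      using excess_mono[of F "insert a F"] deficit_le_weight[of F] a by (intro mult_nonneg_nonneg) auto
    have deficit: "deficit (insert a F) = deficit F"
      using False by (simp add: deficit_def)
    have weight_insert: "M - insert a F = M - F"
      using False by auto
    have "deficit (searched_upto (xs @ [a]) i) = deficit (insert a F) \<and>
        sum x (M - searched_upto (xs @ [a]) i) = \<rho> * deficit (insert a F)"
      if 0: "slack (xs @ [a]) = 0" and i: "i \<in> insert a F - M" for i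
    proof -
      have zero: "slack xs = 0" "?step = 0"
        using 0 slack step IH by linarith+
      show ?thesis
      proof (cases "i = a")
        case True
        have "sum x (M - F) = \<rho> * deficit F"
        \<comment> \<open>If \<open>a\<close> is the first element outside \<open>M\<close>, the
          excess rises strictly from 0, so the other factor of the step vanishes. Otherwise an
          earlier element outside \<open>M\<close> supplies \<open>weight\<close>.\<close>
        proof (cases "F \<subseteq> M")
          case True
          then have "excess F = 0" "excess (insert a F) = f (M \<union> {a}) - f M"
            by (auto simp: excess_def Un_absorb2)
          moreover have "f M < f (M \<union> {a})"
            using a \<open>a \<notin> M\<close> by (intro f_less_union) auto
          ultimately show ?thesis
            using zero(2) by simp
        next
          case False
          then show ?thesis
            using weight[OF zero(1)] by blast
        qed
        then show ?thesis
          by (simp only: True new deficit weight_insert)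
      next
        case False
        then show ?thesis
          using IH0[OF zero(1), of i] i by (simp add: old deficit)
      qed
    qed
    then show ?thesis
      using slack step IH unfolding set by auto
  next
    case True
    let ?step = "(\<rho> * excess F - sum x (F - M)) * (deficit F - deficit (insert a F))"
    have slack: "slack (xs @ [a]) = slack xs + ?step"
      using slack_snoc[of a xs] potential_step_inside[OF True a(1)] a(1) by (simp add: F_def)
    have step: "0 \<le> ?step"
      using surplus(1)[OF a(3)] deficit_antimono[of F "insert a F"] by (intro mult_nonneg_nonneg) auto
    have "deficit (searched_upto (xs @ [a]) i) = deficit (insert a F) \<and>
        sum x (M - searched_upto (xs @ [a]) i) = \<rho> * deficit (insert a F)"
      if 0: "slack (xs @ [a]) = 0" and i: "i \<in> insert a F - M" for i
    proof -
      have zero: "slack xs = 0" "?step = 0"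
        using 0 slack step IH by linarith+
      have "i \<in> F - M"
        using i True by auto
      \<comment> \<open>Once an element outside \<open>M\<close> has been searched, the first factor
        is strictly positive, so the deficit can no longer change.\<close>
      then have "0 < \<rho> * excess F - sum x (F - M)"
        using surplus(2)[OF a(3)] by blast
      then have "deficit (insert a F) = deficit F"
        using zero(2) by simp
      then show ?thesis
        using IH0[OF zero(1) \<open>i \<in> F - M\<close>] old \<open>i \<in> F - M\<close> by simp
    qed
    then show ?thesis
      using slack step IH unfolding set by auto
  qed
qed

text \<open>The potential of \<open>S\<close> vanishes, so the slack is the sum of the gains, and
  each gain is bounded by submodularity applied to \<open>M\<close> and the set searched up to
  \<open>j\<close>.\<close>

lemma slack_le_cost_diff:
  assumes "xs \<in> permutations_of_set S"
  shows "slack xs \<le> search_cost S f x xs - search_cost S f x (search_first M xs)"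
proof -
  have xs: "set xs = S" "distinct xs"
    using assms by (auto simp: permutations_of_set_def)
  have "slack xs = (\<Sum>j\<in>S. gain (searched_upto xs j) j)"
    using M_subset by (simp add: slack_def xs potential_def deficit_def Int_absorb2
      Diff_eq_empty_iff[THEN iffD2])
  also have "\<dots> \<le> (\<Sum>j\<in>S. x j * f (searched_upto xs j) - x j * f (searched_upto (search_first M xs) j))"
  proof (rule sum_mono)
    fix j assume j: "j \<in> S"
    have "searched_upto xs j \<subseteq> S"
      using searched_upto_subset[of j xs] j by (simp add: xs)
    then have "f (M \<union> searched_upto xs j) + f (M \<inter> searched_upto xs j) \<le>
        f M + f (searched_upto xs j)"
      using M_subset by (intro f_submodular)
    \<comment> \<open>The first form serves \<open>j\<close> in \<open>M\<close>, the second
      \<open>j\<close> outside \<open>M\<close>.\<close>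
    then have "f (M \<union> searched_upto xs j) - f M \<le> f (searched_upto xs j) - f (M \<inter> searched_upto xs j)"
      "- (f M - f (M \<inter> searched_upto xs j)) \<le> f (searched_upto xs j) - f (M \<union> searched_upto xs j)"
      by linarith+
    from this[THEN mult_left_mono, OF x_nonneg[OF j] ]
    show "gain (searched_upto xs j) j \<le>
        x j * f (searched_upto xs j) - x j * f (searched_upto (search_first M xs) j)"
      using searched_upto_search_first[OF xs(2), of j M] j M_subset
      by (simp add: xs gain_def excess_def deficit_def right_diff_distrib)
  qed
  also have "\<dots> = search_cost S f x xs - search_cost S f x (search_first M xs)"
    by (simp add: search_cost_def sum_subtractf)
  finally show ?thesis .
qed

text \<open>Moving \<open>M\<close> to the front cannot help, so the slack is zero and, before any
  \<open>i\<close> outside \<open>M\<close>, the deficit and the unsearched weight of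
  \<open>M\<close> are 0. Hence positive weight in \<open>M\<close> is found before leaving
  \<open>M\<close>, and submodularity carries the strict increase of \<open>f\<close> from
  \<open>M\<close> to \<open>M \<union> searched_upto xs i\<close> over to
  \<open>searched_upto xs i\<close>.\<close>

lemma optimal_search:
  assumes xs: "xs \<in> permutations_of_set S"
    and opt: "\<And>ys. ys \<in> permutations_of_set S \<Longrightarrow> search_cost S f x xs \<le> search_cost S f x ys"
  shows "j \<in> M \<Longrightarrow> 0 < x j \<Longrightarrow> f (searched_upto xs j) \<le> f M"
    and "i \<in> S \<Longrightarrow> i \<notin> M \<Longrightarrow> f M < f (searched_upto xs i)"
proof -
  have set: "set xs = S" "distinct xs"
    using xs by (auto simp: permutations_of_set_def)
  have "slack xs \<le> 0"
    using slack_le_cost_diff[OF xs] opt[OF search_first_permutation[OF xs, of M]] by linarith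
  moreover have "deficit S = 0"
    using M_subset by (simp add: deficit_def Int_absorb2)
  ultimately have tight: "deficit (searched_upto xs i) = 0" "sum x (M - searched_upto xs i) = 0"
    if "i \<in> S" "i \<notin> M" for i
    using slack_nonneg_and_tight[of xs] that by (auto simp: set)
  have sub: "searched_upto xs i \<subseteq> S" if "i \<in> S" for i
    using searched_upto_subset[of i xs] that by (simp add: set)
  show "f (searched_upto xs j) \<le> f M" if j: "j \<in> M" "0 < x j"
  proof -
    have "searched_upto xs j \<subseteq> M"
    proof
      fix i assume i: "i \<in> searched_upto xs j"
      show "i \<in> M"
      proof (rule ccontr)
        assume "i \<notin> M"
        have "i \<in> S"
          using i sub[of j] j M_subset by auto
        \<comment> \<open>If \<open>i\<close> precedes \<open>j\<close>, then \<open>j\<close> is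
          still unsearched at \<open>i\<close> and its positive weight contradicts
          \<open>tight\<close>.\<close>
        have "j \<notin> searched_upto xs i"
          using searched_upto_antisym[OF set(2), of j i] i j M_subset \<open>i \<notin> M\<close> by (auto simp: set)
        then have "sum x {j} \<le> sum x (M - searched_upto xs i)"
          using j M_subset by (intro x_mono) auto
        then show False
          using tight(2)[OF \<open>i \<in> S\<close> \<open>i \<notin> M\<close>] j by simp
      qed
    qed
    then show ?thesis
      using M_subset by (rule f_mono)
  qed
  show "f M < f (searched_upto xs i)" if i: "i \<in> S" "i \<notin> M"
  proof -
    have "f (M \<union> searched_upto xs i) + f (M \<inter> searched_upto xs i) \<le> f M + f (searched_upto xs i)"
      using M_subset sub[OF i(1)] by (rule f_submodular)
    moreover have "f (M \<inter> searched_upto xs i) = f M"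
      using tight(1)[OF i] by (simp add: deficit_def)
    moreover have "f M < f (M \<union> searched_upto xs i)"
      using sub[OF i(1)] searched_upto_refl[of i xs] i by (intro f_less_union) auto
    ultimately show ?thesis
      by linarith
  qed
qed

end

section \<open>Equilibria\<close>

text \<open>Take \<open>\<rho>\<close> as the maximal density over non-empty sets; \<open>B\<close>
  forces it to be positive. Tight sets are closed under union, so one of maximal cardinality
  contains all others. It is non-empty because the maximum is attained at a non-empty set.\<close>

lemma ex_densest_set:
  fixes f :: "'a set \<Rightarrow> real" and x :: "'a \<Rightarrow> real"
  assumes "finite S" "mono_on (Pow S) f" "submodular_on S f" "f {} = 0"
    and pos: "\<And>A. A \<subseteq> S \<Longrightarrow> A \<noteq> {} \<Longrightarrow> 0 < f A"
    and x: "\<And>j. j \<in> S \<Longrightarrow> 0 \<le> x j"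
    and B: "B \<subseteq> S" "0 < sum x B"
  obtains M \<rho> where "densest_set S f x M \<rho>" "M \<noteq> {}" "sum x B \<le> \<rho> * f B"
proof -
  let ?D = "(\<lambda>A. sum x A / f A) ` (Pow S - {{}})"
  define \<rho> where "\<rho> = Max ?D"
  have B_ne: "B \<noteq> {}"
    using B by auto
  then have D: "finite ?D" "?D \<noteq> {}"
    using assms(1) B by auto
  have dens: "sum x A \<le> \<rho> * f A" if "A \<subseteq> S" for A
  proof (cases "A = {}")
    case False
    then have "sum x A / f A \<le> \<rho>"
      unfolding \<rho>_def using D that by (intro Max_ge) auto
    then show ?thesis
      using pos[OF that False] by (simp add: divide_le_eq)
  qed (simp add: assms(4))
  have "0 < \<rho> * f B"
    using dens[OF B(1)] B(2) by linarith
  then have "0 < \<rho>"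
    using pos[OF B(1) B_ne] by (simp add: zero_less_mult_iff)
  define T where "T = {A. A \<subseteq> S \<and> sum x A = \<rho> * f A}"
  have "finite T" "{} \<in> T"
    using assms(1,4) by (auto simp: T_def)
  then have "Max (card ` T) \<in> card ` T"
    by (intro Max_in) auto
  then obtain M where "M \<in> T" "card M = Max (card ` T)"
    by auto
  with \<open>finite T\<close> have M: "M \<in> T" "\<And>A. A \<in> T \<Longrightarrow> card A \<le> card M"
    by simp_all
  have submod: "f (A \<union> C) + f (A \<inter> C) \<le> f A + f C" if "A \<subseteq> S" "C \<subseteq> S" for A C
    using assms(3) that by (auto simp: submodular_on_def)
  \<comment> \<open>\<open>\<rho> f - x\<close> is submodular and non-negative, so its zero sets are closed under union.\<close>
  have union: "A \<union> M \<in> T" if "A \<in> T" for A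
  proof -
    have sub: "A \<subseteq> S" "M \<subseteq> S"
      using that M(1) by (auto simp: T_def)
    then have "sum x (A \<union> M) + sum x (A \<inter> M) = sum x A + sum x M"
      using assms(1) by (intro sum.union_inter) (auto dest: finite_subset)
    also have "\<dots> = \<rho> * (f A + f M)"
      using that M(1) by (simp add: T_def algebra_simps)
    also have "\<dots> \<ge> \<rho> * (f (A \<union> M) + f (A \<inter> M))"
      using submod[OF sub] \<open>0 < \<rho>\<close> by simp
    finally have "\<rho> * (f (A \<union> M) + f (A \<inter> M)) \<le> sum x (A \<union> M) + sum x (A \<inter> M)" .
    then have "\<rho> * f (A \<union> M) + \<rho> * f (A \<inter> M) \<le> sum x (A \<union> M) + sum x (A \<inter> M)"
      by (simp add: algebra_simps)
    moreover have "sum x (A \<union> M) \<le> \<rho> * f (A \<union> M)" "sum x (A \<inter> M) \<le> \<rho> * f (A \<inter> M)"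
      using sub by (auto intro!: dens)
    ultimately show ?thesis
      using sub by (auto simp: T_def)
  qed
  have largest: "A \<subseteq> M" if "A \<in> T" for A
  proof -
    have "finite (A \<union> M)"
      using that M(1) assms(1) by (auto simp: T_def dest: finite_subset)
    then have "M = A \<union> M"
      using M(2)[OF union[OF that]] by (intro card_seteq) auto
    then show ?thesis
      by blast
  qed
  have "densest_set S f x M \<rho>"
    using assms(1) x \<open>0 < \<rho>\<close> dens submod M(1) largest assms(2)
    by unfold_locales (auto simp: T_def mono_on_def)
  moreover have "M \<noteq> {}"
  proof -
    have "\<rho> \<in> ?D"
      unfolding \<rho>_def using D by (rule Max_in)
    then obtain A where A: "A \<subseteq> S" "A \<noteq> {}" "\<rho> = sum x A / f A"
      by blast
    then have "A \<in> T"
      using pos[of A] by (simp add: T_def)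
    then show ?thesis
      using largest A(2) by blast
  qed
  ultimately show thesis
    using dens[OF B(1)] by (rule that)
qed

section \<open>Payoffs, pure strategies and complementary slackness\<close>

lemma expected_payoff_eq_search_cost:
  "expected_payoff S f p x = (\<Sum>xs\<in>permutations_of_set S. p xs * search_cost S f x xs)"
  by (simp add: expected_payoff_def search_cost_def sum_distrib_left mult.assoc)

lemma expected_payoff_eq_hider:
  "expected_payoff S f p x =
    (\<Sum>j\<in>S. x j * (\<Sum>xs\<in>permutations_of_set S. p xs * f (searched_upto xs j)))"
  unfolding expected_payoff_def
  by (subst sum.swap) (simp add: sum_distrib_left mult_ac)

text \<open>Restricted to \<open>X\<close> because members of \<open>mixed_strategies X\<close> are
  extensional.\<close>

definition pure :: "'b set \<Rightarrow> 'b \<Rightarrow> 'b \<Rightarrow> real" where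
  "pure X a = (\<lambda>b\<in>X. if b = a then 1 else 0)"

lemma pure_mixed: "finite X \<Longrightarrow> a \<in> X \<Longrightarrow> pure X a \<in> mixed_strategies X"
  by (auto simp: pure_def mixed_strategies_def)

lemma sum_pure: "finite X \<Longrightarrow> a \<in> X \<Longrightarrow> (\<Sum>b\<in>X. pure X a b * h b) = h a"
  by (simp add: pure_def if_distrib[of "\<lambda>t. t * _"] cong: if_cong)

lemma mixed_nonneg: "w \<in> mixed_strategies X \<Longrightarrow> a \<in> X \<Longrightarrow> 0 \<le> w a"
  by (auto simp: mixed_strategies_def PiE_def Pi_def)

text \<open>The differences between \<open>h\<close> and its average are non-negative with weighted
  sum 0, so each weighted term vanishes. It is applied to both players.\<close>

lemma average_minimal_imp_support_minimal:
  assumes X: "finite X" and w: "w \<in> mixed_strategies X"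
    and le: "\<And>b. b \<in> X \<Longrightarrow> (\<Sum>a\<in>X. w a * h a) \<le> h b"
    and b: "b \<in> X" "0 < w b"
  shows "h b = (\<Sum>a\<in>X. w a * h a)"
proof -
  let ?V = "\<Sum>a\<in>X. w a * h a"
  have "(\<Sum>a\<in>X. w a * (h a - ?V)) = ?V - sum w X * ?V"
    by (simp add: right_diff_distrib sum_subtractf sum_distrib_right)
  also have "\<dots> = 0"
    using w by (simp add: mixed_strategies_def)
  finally have "\<forall>a\<in>X. w a * (h a - ?V) = 0"
    using X le mixed_nonneg[OF w] by (subst (asm) sum_nonneg_eq_0_iff) auto
  then show ?thesis
    using b by auto
qed

theorem theorem7:
  fixes S :: "'a set" and f :: "'a set \<Rightarrow> real" and x :: "'a \<Rightarrow> real"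
  assumes "finite S" and "S \<noteq> {}"
    and "f \<in> Pow S \<rightarrow> {0..}"
    and "mono_on (Pow S) f"
    and "submodular_on S f"
    and "f {} = 0"
    and "\<And>A. A \<subseteq> S \<Longrightarrow> A \<noteq> {} \<Longrightarrow> f A > 0"
    and "hider_equilibrium_strategy S f x"
  shows "x \<in> scale_on S (1 / f S) (base_polyhedron S f)"
proof -
  let ?P = "permutations_of_set S"
  obtain p where p: "p \<in> mixed_strategies ?P" and x: "x \<in> mixed_strategies S"
    and searcher: "\<And>q. q \<in> mixed_strategies ?P \<Longrightarrow> expected_payoff S f p x \<le> expected_payoff S f q x"
    and hider: "\<And>y. y \<in> mixed_strategies S \<Longrightarrow> expected_payoff S f p y \<le> expected_payoff S f p x"
    using assms(8) by (auto simp: hider_equilibrium_strategy_def equilibrium_def)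
  define V where "V = expected_payoff S f p x"
  define E where "E j = (\<Sum>xs\<in>?P. p xs * f (searched_upto xs j))" for j
  have "finite ?P"
    by simp
  have x_sum: "sum x S = 1"
    using x by (simp add: mixed_strategies_def)
  have fS: "0 < f S"
    using assms(2,7) by simp
  \<comment> \<open>Test the Searcher's optimality against pure searches.\<close>
  have V_le: "V \<le> search_cost S f x xs" if "xs \<in> ?P" for xs
    using searcher[OF pure_mixed[OF \<open>finite ?P\<close> that]] sum_pure[OF \<open>finite ?P\<close> that, of "search_cost S f x"]
    by (simp add: V_def expected_payoff_eq_search_cost)
  have V_cost: "search_cost S f x xs = V" if "xs \<in> ?P" "0 < p xs" for xs
    unfolding V_def expected_payoff_eq_search_cost
    by (rule average_minimal_imp_support_minimal[OF \<open>finite ?P\<close> p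
        V_le[unfolded V_def expected_payoff_eq_search_cost] that])
  have E_le: "E j \<le> V" if "j \<in> S" for j
    using hider[OF pure_mixed[OF assms(1) that]] sum_pure[OF assms(1) that, of E]
    by (simp add: V_def E_def expected_payoff_eq_hider)
  have V_eq: "V = (\<Sum>j\<in>S. x j * E j)"
    by (simp add: V_def E_def expected_payoff_eq_hider)
  have E_eq: "E j = V" if "j \<in> S" "0 < x j" for j
  proof -
    \<comment> \<open>The Hider maximizes, hence the negated payoffs.\<close>
    have "- E j = (\<Sum>i\<in>S. x i * - E i)"
    proof (rule average_minimal_imp_support_minimal[OF assms(1) x _ that])
      show "(\<Sum>i\<in>S. x i * - E i) \<le> - E b" if "b \<in> S" for b
        using E_le[OF that] V_eq by (simp add: sum_negf)
    qed
    then show ?thesis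
      using V_eq by (simp add: sum_negf)
  qed
  have feasible: "sum x B \<le> f B / f S" if B: "B \<subseteq> S" for B
  proof (rule ccontr)
    assume "\<not> sum x B \<le> f B / f S"
    then have B_gt: "f B / f S < sum x B"
      by simp
    moreover have "0 \<le> f B / f S"
      using assms(3) B fS by (auto intro!: divide_nonneg_pos)
    ultimately have B_pos: "0 < sum x B"
      by linarith
    then have "B \<noteq> {}"
      by auto
    then have fB: "0 < f B"
      using assms(7) B by simp
    obtain M \<rho> where M: "densest_set S f x M \<rho>" and M_ne: "M \<noteq> {}" and "sum x B \<le> \<rho> * f B"
      using ex_densest_set[OF assms(1,4,5,6,7) mixed_nonneg[OF x] B B_pos] by metis
    interpret densest_set S f x M \<rho>
      by (rule M)
    \<comment> \<open>The violation at \<open>B\<close> puts \<open>\<rho>\<close> above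
      \<open>1 / f S\<close>, the density of \<open>S\<close>, so \<open>S\<close> is not tight and
      \<open>M\<close> is proper.\<close>
    have "f B / f S < \<rho> * f B"
      using B_gt \<open>sum x B \<le> \<rho> * f B\<close> by linarith
    then have "1 < \<rho> * f S"
      using fB fS by (simp add: field_simps)
    then have "M \<noteq> S"
      using M_tight x_sum by auto
    then obtain i where i: "i \<in> S" "i \<notin> M"
      using M_subset by blast
    have "0 < f M"
      using assms(7) M_subset M_ne by simp
    then have "0 < sum x M"
      using M_tight \<rho>_pos by simp
    then obtain j where j: "j \<in> M" "0 < x j"
      by (meson not_le sum_nonpos)
    obtain ys where ys: "ys \<in> ?P" "0 < p ys"
    proof -
      have "0 < sum p ?P"
        using p by (simp add: mixed_strategies_def)
      then show thesis
        using that by (meson not_le sum_nonpos)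
    qed
    \<comment> \<open>The value \<open>f M\<close> separates the two costs in every search that
      \<open>p\<close> uses; \<open>ys\<close> later provides one such search for
      strictness.\<close>
    have less: "f (searched_upto xs j) < f (searched_upto xs i)" if "xs \<in> ?P" "0 < p xs" for xs
    proof -
      have "search_cost S f x xs \<le> search_cost S f x zs" if "zs \<in> ?P" for zs
        using V_cost[OF \<open>xs \<in> ?P\<close> \<open>0 < p xs\<close>] V_le[OF that] by simp
      then show ?thesis
        using optimal_search[OF \<open>xs \<in> ?P\<close>] j i by (meson le_less_trans)
    qed
    have "E j < E i"
      unfolding E_def
    proof (rule sum_strict_mono_ex1)
      show "\<forall>xs\<in>?P. p xs * f (searched_upto xs j) \<le> p xs * f (searched_upto xs i)"
        using less mixed_nonneg[OF p] by (metis less_eq_real_def mult_left_mono mult_zero_left)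
      show "\<exists>xs\<in>?P. p xs * f (searched_upto xs j) < p xs * f (searched_upto xs i)"
        using less ys by (meson mult_strict_left_mono)
    qed simp
    \<comment> \<open>As \<open>j\<close> has positive weight, \<open>E j\<close> is the value
      \<open>V\<close>, which \<open>E i\<close> cannot exceed.\<close>
    then show False
      using E_eq[of j] E_le[of i] i j M_subset by auto
  qed
  \<comment> \<open>The only candidate for a point of the base polyhedron that scales to
    \<open>x\<close>.\<close>
  define y where "y = (\<lambda>s\<in>S. f S * x s)"
  have sum_y: "sum y A = f S * sum x A" if "A \<subseteq> S" for A
    using that unfolding y_def sum_distrib_left by (intro sum.cong) auto
  have "y \<in> S \<rightarrow>\<^sub>E UNIV"
    by (auto simp: y_def)
  moreover have "sum y A \<le> f A" if "A \<subseteq> S" for A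
    using feasible[OF that] fS by (simp add: sum_y[OF that] field_simps)
  moreover have "sum y S = f S"
    by (simp add: sum_y x_sum)
  ultimately have "y \<in> base_polyhedron S f"
    by (simp add: base_polyhedron_def)
  moreover have "x = (\<lambda>s\<in>S. 1 / f S * y s)"
  proof
    fix s
    show "x s = (\<lambda>s\<in>S. 1 / f S * y s) s"
      using x fS by (cases "s \<in> S") (auto simp: y_def mixed_strategies_def PiE_def extensional_def)
  qed
  ultimately show ?thesis
    unfolding scale_on_def by blast
qed

end
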